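(* Let $L$ be a finite-dimensional solvable Lie algebra over a field $\mathbb{F}$ of characteristic $p\geq 0$ and suppose that $L$ admits a non-singular derivation of finite order. If either $p=0$ or $\dim L^{(i)}/L^{(i+1)}<p$ for all $i$, then $L$ is nilpotent.
   Context: The derived series of a Lie algebra $L$ is defined by $L^{(0)}=L$ and $L^{(i)}=[L^{(i-1)},L^{(i-1)}]$ for $i\geq 1$. A derivation $\delta$ of $L$ is non-singular if it is an invertible linear map; it has finite order if $\delta^n=\mathrm{id}$ for some $n\geq 1$ (multiplicative order under composition). *)

theory Defs
  imports Complex_Main
begin

section \<open>Dimension of a quotient of subspaces\<close>

locale vector_space_quotient = vector_space scale
  for scale :: "'a::field \<Rightarrow> 'b::ab_group_add \<Rightarrow> 'b"
begin

definition coset :: "'b set \<Rightarrow> 'b \<Rightarrow> 'b set"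
  where "coset W x = (\<lambda>w. x + w) ` W"

definition quot :: "'b set \<Rightarrow> 'b set \<Rightarrow> 'b set set"
  where "quot V W = coset W ` V"

definition quot_add :: "'b set \<Rightarrow> 'b set \<Rightarrow> 'b set"
  where "quot_add A B = {a + b | a b. a \<in> A \<and> b \<in> B}"

text \<open>The summand from \<open>W\<close> makes \<open>0\<close> times a coset equal to \<open>W\<close> rather than to \<open>{0}\<close>.\<close>

definition quot_scale :: "'b set \<Rightarrow> 'a \<Rightarrow> 'b set \<Rightarrow> 'b set"
  where "quot_scale W c A = {scale c a + w | a w. a \<in> A \<and> w \<in> W}"

definition quot_subspace :: "'b set \<Rightarrow> 'b set \<Rightarrow> 'b set set \<Rightarrow> bool"
  where "quot_subspace V W T \<longleftrightarrow> T \<subseteq> quot V W \<and> W \<in> T \<and>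
    (\<forall>A\<in>T. \<forall>B\<in>T. quot_add A B \<in> T) \<and> (\<forall>c. \<forall>A\<in>T. quot_scale W c A \<in> T)"

definition quot_span :: "'b set \<Rightarrow> 'b set \<Rightarrow> 'b set set \<Rightarrow> 'b set set"
  where "quot_span V W S = quot_subspace V W hull S"

definition quot_basis :: "'b set \<Rightarrow> 'b set \<Rightarrow> 'b set set \<Rightarrow> bool"
  where "quot_basis V W S \<longleftrightarrow> S \<subseteq> quot V W \<and> quot_span V W S = quot V W \<and>
    (\<forall>A\<in>S. A \<notin> quot_span V W (S - {A}))"

text \<open>As for \<^const>\<open>dim\<close>, the value is meaningful only if a finite basis exists.\<close>

definition quot_dim :: "'b set \<Rightarrow> 'b set \<Rightarrow> nat"
  where "quot_dim V W =
    (if \<exists>S. quot_basis V W S then card (SOME S. quot_basis V W S) else 0)"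

lemma coset_eq_iff:
  assumes W: "subspace W"
  shows "coset W x = coset W y \<longleftrightarrow> x - y \<in> W"
proof
  assume "coset W x = coset W y"
  moreover have "x \<in> coset W x"
    using subspace_0[OF W] by (force simp: coset_def)
  ultimately show "x - y \<in> W" by (auto simp: coset_def)
next
  assume d: "x - y \<in> W"
  have *: "coset W x \<subseteq> coset W y" if "x - y \<in> W" for x y
  proof
    fix z assume "z \<in> coset W x"
    then obtain w where "w \<in> W" "z = x + w" by (auto simp: coset_def)
    then have "z = y + ((x - y) + w)" "(x - y) + w \<in> W"
      using that subspace_add[OF W] by auto
    then show "z \<in> coset W y" unfolding coset_def by blast
  qed
  have "y - x \<in> W" using subspace_neg[OF W d] by simp
  with * d show "coset W x = coset W y" by blast
qed

lemma quot_add_coset: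
  assumes W: "subspace W"
  shows "quot_add (coset W x) (coset W y) = coset W (x + y)"
proof
  show "quot_add (coset W x) (coset W y) \<subseteq> coset W (x + y)"
  proof
    fix z assume "z \<in> quot_add (coset W x) (coset W y)"
    then obtain u v where "u \<in> W" "v \<in> W" "z = (x + u) + (y + v)"
      by (auto simp: quot_add_def coset_def)
    then have "z = (x + y) + (u + v)" "u + v \<in> W"
      using subspace_add[OF W] by (auto simp: algebra_simps)
    then show "z \<in> coset W (x + y)" unfolding coset_def by blast
  qed
  show "coset W (x + y) \<subseteq> quot_add (coset W x) (coset W y)"
  proof
    fix z assume "z \<in> coset W (x + y)"
    then obtain u where "u \<in> W" "z = (x + 0) + (y + u)"
      by (auto simp: coset_def algebra_simps)
    then show "z \<in> quot_add (coset W x) (coset W y)"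
      using subspace_0[OF W] unfolding quot_add_def coset_def by blast
  qed
qed

lemma quot_scale_coset:
  assumes W: "subspace W"
  shows "quot_scale W c (coset W x) = coset W (scale c x)"
proof
  show "quot_scale W c (coset W x) \<subseteq> coset W (scale c x)"
  proof
    fix z assume "z \<in> quot_scale W c (coset W x)"
    then obtain u v where "u \<in> W" "v \<in> W" "z = scale c (x + u) + v"
      by (auto simp: quot_scale_def coset_def)
    then have "z = scale c x + (scale c u + v)" "scale c u + v \<in> W"
      using subspace_add[OF W] subspace_scale[OF W] by (auto simp: algebra_simps)
    then show "z \<in> coset W (scale c x)" unfolding coset_def by blast
  qed
  show "coset W (scale c x) \<subseteq> quot_scale W c (coset W x)"
  proof
    fix z assume "z \<in> coset W (scale c x)"
    then obtain u where "u \<in> W" "z = scale c (x + 0) + u"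
      by (auto simp: coset_def)
    then show "z \<in> quot_scale W c (coset W x)"
      using subspace_0[OF W] unfolding quot_scale_def coset_def by blast
  qed
qed

lemma coset_zero: "coset W 0 = W"
  by (simp add: coset_def)

lemma coset_in_image_iff:
  assumes W: "subspace W" and U: "subspace U" "W \<subseteq> U"
  shows "coset W x \<in> coset W ` U \<longleftrightarrow> x \<in> U"
proof
  assume "coset W x \<in> coset W ` U"
  then obtain u where "u \<in> U" "x - u \<in> W"
    using coset_eq_iff[OF W] by auto
  then have "u + (x - u) \<in> U" using U subspace_add by blast
  then show "x \<in> U" by simp
qed auto

lemma quot_span_coset:
  assumes W: "subspace W" and V: "subspace V" and WV: "W \<subseteq> V" and R: "R \<subseteq> V"
  shows "quot_span V W (coset W ` R) = coset W ` span (R \<union> W)"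
proof
  have "span (R \<union> W) \<subseteq> V" using span_minimal V WV R by simp
  moreover have "W \<in> coset W ` span (R \<union> W)"
    using span_zero coset_zero by (metis image_eqI)
  ultimately have "quot_subspace V W (coset W ` span (R \<union> W))"
    unfolding quot_subspace_def quot_def
    by (auto simp: quot_add_coset[OF W] quot_scale_coset[OF W]
        intro: span_add span_scale)
  moreover have "coset W ` R \<subseteq> coset W ` span (R \<union> W)"
    using span_superset by blast
  ultimately show "quot_span V W (coset W ` R) \<subseteq> coset W ` span (R \<union> W)"
    unfolding quot_span_def by (intro hull_minimal)
  show "coset W ` span (R \<union> W) \<subseteq> quot_span V W (coset W ` R)"
    unfolding quot_span_def hull_def
  proof (clarsimp)
    fix x T assume T: "quot_subspace V W T" "coset W ` R \<subseteq> T" and x: "x \<in> span (R \<union> W)"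
    have T0: "W \<in> T" using T(1) by (simp add: quot_subspace_def)
    have "subspace {y. coset W y \<in> T}"
      using T(1) unfolding quot_subspace_def
      by (auto intro!: subspaceI simp: coset_zero
          simp flip: quot_add_coset[OF W] quot_scale_coset[OF W])
    moreover have "coset W w \<in> T" if "w \<in> W" for w
      using that T0 coset_eq_iff[OF W, of w 0] coset_zero by simp
    then have "R \<union> W \<subseteq> {y. coset W y \<in> T}" using T(2) by auto
    ultimately show "coset W x \<in> T" using span_minimal x by blast
  qed
qed

text \<open>The quotient dimension is the expected number.\<close>

lemma quot_dim_eq:
  assumes fd: "finite_dimensional_vector_space scale B"
    and W: "subspace W" and V: "subspace V" and WV: "W \<subseteq> V"
  shows "quot_dim V W = dim V - dim W"
proof -
  interpret finite_dimensional_vector_space scale B by (rule fd)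
  obtain C where C: "C \<subseteq> W" "independent C" "W \<subseteq> span C" "card C = dim W"
    using basis_exists by metis
  have spanC: "span C = W" using C W span_minimal by blast
  have un: "span (R \<union> C) = span (R \<union> W)" for R
    unfolding span_Un spanC using W by (simp only: span_eq_iff[THEN iffD2])
  have card: "card S = dim V - dim W" if S: "quot_basis V W S" for S
  proof -
    have "\<exists>R. R \<subseteq> V \<and> inj_on (coset W) R \<and> S = coset W ` R"
      using S unfolding quot_basis_def quot_def by (meson subset_image_inj)
    then obtain R where R: "R \<subseteq> V" "inj_on (coset W) R" "S = coset W ` R" by blast
    have spV: "span (R \<union> W) = V"
    proof -
      have sub: "span (R \<union> W) \<subseteq> V" using span_minimal V WV R by simp
      have "coset W ` span (R \<union> W) = coset W ` V"
        using S R quot_span_coset[OF W V WV R(1)] by (simp add: quot_basis_def quot_def)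
      moreover have "W \<subseteq> span (R \<union> W)" using span_superset by blast
      ultimately have "x \<in> span (R \<union> W)" if "x \<in> V" for x
        using coset_in_image_iff[OF W subspace_span, of "R \<union> W" x] that by blast
      then show ?thesis using sub by blast
    qed
    have nr: "r \<notin> span ((R - {r}) \<union> W)" if r: "r \<in> R" for r
    proof
      assume "r \<in> span ((R - {r}) \<union> W)"
      then have "coset W r \<in> quot_span V W (coset W ` (R - {r}))"
        using quot_span_coset[OF W V WV, of "R - {r}"] R(1) by blast
      moreover have "coset W ` (R - {r}) = S - {coset W r}"
        using R r by (auto simp: inj_on_def)
      ultimately show False using S R r by (auto simp: quot_basis_def)
    qed
    have disj: "R \<inter> C = {}"
      using nr C span_superset by blast
    have fin: "finite (R' \<union> C) \<and> independent (R' \<union> C)" if "finite R'" "R' \<subseteq> R" for R'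
      using that
    proof (induction R' rule: finite_induct)
      case empty
      then show ?case using C finiteI_independent by simp
    next
      case (insert r R')
      have "r \<notin> span (R' \<union> C)"
      proof
        assume "r \<in> span (R' \<union> C)"
        then have "r \<in> span (R' \<union> W)" by (simp add: un)
        moreover have "R' \<union> W \<subseteq> (R - {r}) \<union> W" using insert by auto
        ultimately show False using nr[of r] span_mono insert by blast
      qed
      then show ?case using insert independent_insertI by simp
    qed
    have finR: "finite R"
    proof (rule ccontr)
      assume "infinite R"
      then obtain R' where R': "R' \<subseteq> R" "finite R'" "card R' = Suc (card B)"
        using infinite_arbitrarily_large by blast
      then have "independent R'" using fin independent_mono by blast
      then have "card R' \<le> card B"
        using independent_card_le_dim[of R' UNIV] dim_UNIV dimension_def by simp
      then show False using R' by simp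
    qed
    have "dim V = card (R \<union> C)"
      using fin[OF finR] dim_span_eq_card_independent[of "R \<union> C"] by (simp add: un spV)
    also have "\<dots> = card R + card C"
      using disj finR C finiteI_independent by (simp add: card_Un_disjoint)
    finally show ?thesis using R C by (simp add: card_image)
  qed
  have "\<exists>S. quot_basis V W S"
  proof -
    obtain D where D: "C \<subseteq> D" "D \<subseteq> V" "independent D" "V \<subseteq> span D"
      using maximal_independent_subset_extend[of C V] C WV by blast
    let ?R = "D - C"
    have RC: "?R \<union> C = D" using D by blast
    have spV: "span (?R \<union> W) = V"
      using un[of ?R] RC D span_minimal[OF D(2) V] by auto
    have nr: "r \<notin> span ((?R - {r}) \<union> W)" if "r \<in> ?R" for r
    proof -
      have "(?R - {r}) \<union> C = D - {r}" using that D by auto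
      then have "span ((?R - {r}) \<union> W) = span (D - {r})" using un[of "?R - {r}"] by simp
      then show ?thesis using D(3) that unfolding dependent_def by auto
    qed
    have "quot_basis V W (coset W ` ?R)"
      unfolding quot_basis_def
    proof (intro conjI ballI)
      show "coset W ` ?R \<subseteq> quot V W" using D by (auto simp: quot_def)
      show "quot_span V W (coset W ` ?R) = quot V W"
        using quot_span_coset[OF W V WV, of ?R] D spV by (auto simp: quot_def)
      fix A assume "A \<in> coset W ` ?R"
      then obtain r where r: "r \<in> ?R" "A = coset W r" by blast
      let ?R' = "{s \<in> ?R. coset W s \<noteq> A}"
      have eq: "coset W ` ?R - {A} = coset W ` ?R'" by auto
      have sp: "quot_span V W (coset W ` ?R') = coset W ` span (?R' \<union> W)"
        using quot_span_coset[OF W V WV, of ?R'] D by blast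
      have "r \<notin> span (?R' \<union> W)"
        using nr[OF r(1)] span_mono[of "?R' \<union> W" "(?R - {r}) \<union> W"] r by blast
      moreover have "W \<subseteq> span (?R' \<union> W)" using span_superset by blast
      ultimately have "coset W r \<notin> coset W ` span (?R' \<union> W)"
        using coset_in_image_iff[OF W subspace_span, of "?R' \<union> W" r] by blast
      then show "A \<notin> quot_span V W (coset W ` ?R - {A})"
        unfolding eq sp using r by simp
    qed
    then show ?thesis by blast
  qed
  then show ?thesis
    unfolding quot_dim_def using card someI_ex[of "quot_basis V W"] by simp
qed

end


section \<open>Lie algebras\<close>

text \<open>The Lie algebra is the whole type \<open>'b\<close>. Antisymmetry is stated as \<open>[x, x] = 0\<close>, so that
  characteristic two is covered correctly.\<close>

locale lie_algebra = vector_space scale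
  for scale :: "'a::field \<Rightarrow> 'b::ab_group_add \<Rightarrow> 'b" +
  fixes bracket :: "'b \<Rightarrow> 'b \<Rightarrow> 'b"
  assumes bracket_add_left: "bracket (x + y) z = bracket x z + bracket y z"
    and bracket_add_right: "bracket x (y + z) = bracket x y + bracket x z"
    and bracket_scale_left: "bracket (scale c x) y = scale c (bracket x y)"
    and bracket_scale_right: "bracket x (scale c y) = scale c (bracket x y)"
    and bracket_self: "bracket x x = 0"
    and jacobi: "bracket x (bracket y z) + bracket y (bracket z x) + bracket z (bracket x y) = 0"
begin

definition bracket_span :: "'b set \<Rightarrow> 'b set \<Rightarrow> 'b set"
  where "bracket_span A B = span {bracket x y | x y. x \<in> A \<and> y \<in> B}"

primrec derived_series :: "nat \<Rightarrow> 'b set" where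
  "derived_series 0 = UNIV"
| "derived_series (Suc i) = bracket_span (derived_series i) (derived_series i)"

primrec lower_central_series :: "nat \<Rightarrow> 'b set" where
  "lower_central_series 0 = UNIV"
| "lower_central_series (Suc i) = bracket_span UNIV (lower_central_series i)"

definition solvable :: bool
  where "solvable \<longleftrightarrow> (\<exists>n. derived_series n = {0})"

definition nilpotent :: bool
  where "nilpotent \<longleftrightarrow> (\<exists>n. lower_central_series n = {0})"

definition derivation :: "('b \<Rightarrow> 'b) \<Rightarrow> bool"
  where "derivation d \<longleftrightarrow> Vector_Spaces.linear scale scale d \<and>
    (\<forall>x y. d (bracket x y) = bracket (d x) y + bracket x (d y))"

definition nonsingular_derivation :: "('b \<Rightarrow> 'b) \<Rightarrow> bool"
  where "nonsingular_derivation d \<longleftrightarrow> derivation d \<and> bij d"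

end

definition finite_order :: "('b \<Rightarrow> 'b) \<Rightarrow> bool"
  where "finite_order d \<longleftrightarrow> (\<exists>n\<ge>1. d ^^ n = id)"

end

theory Submission
  imports Defs "HOL-Computational_Algebra.Polynomial"
begin

text \<open>If \<open>D\<close> is a derivation of a commutative algebra and \<open>f x = 0\<close>, then applying \<open>D\<close> and
  multiplying by \<open>D x\<close> repeatedly yields \<open>f\<^sup>(\<^sup>j\<^sup>) x * (D x)\<^sup>2\<^sup>j\<^sup>-\<^sup>1 = 0\<close> for all \<open>j \<ge> 1\<close>. If
  \<open>deg f\<close> is smaller than the characteristic, or the latter is \<open>0\<close>, then
  \<open>j = deg f\<close> makes the first factor a nonzero constant, so \<open>D x\<close> is nilpotent. No eigenvalues, hence no extension of the field, are needed.

  Apply this to the operators \<open>ad x\<close> on \<open>W / U\<close>, for ideals \<open>U \<subset> W\<close> between \<open>L\<^sup>(\<^sup>i\<^sup>+\<^sup>1\<^sup>)\<close> and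
  \<open>L\<^sup>(\<^sup>i\<^sup>)\<close> stable under \<open>\<delta>\<close>, where \<open>D\<close> is the commutator with \<open>\<delta>\<close>, which maps \<open>ad x\<close> to
  \<open>ad (\<delta> x)\<close>. Let \<open>\<gamma>\<^sub>c \<subseteq> L\<^sup>(\<^sup>i\<^sup>)\<close>, so that \<open>\<gamma>\<^sub>c\<close> kills \<open>W / U\<close>. Downwards in \<open>j\<close>, one has
  \<open>[\<gamma>\<^sub>j, W] + U \<noteq> W\<close>: the elements of \<open>\<gamma>\<^sub>j\<close> commute on \<open>W\<close> modulo \<open>[\<gamma>\<^sub>j\<^sub>+\<^sub>1, W] + U\<close> and, since
  \<open>\<delta>\<close> is surjective on \<open>\<gamma>\<^sub>j\<close>, act nilpotently. The case \<open>j = 0\<close>, used repeatedly, gives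
  \<open>\<gamma>\<^sub>c' \<subseteq> L\<^sup>(\<^sup>i\<^sup>+\<^sup>1\<^sup>)\<close> for some \<open>c'\<close>.\<close>

section \<open>Polynomials in a linear operator\<close>

locale vector_space_operator = vector_space scale
  for scale :: "'a::field \<Rightarrow> 'b::ab_group_add \<Rightarrow> 'b"
begin

definition poly_op :: "('b \<Rightarrow> 'b) \<Rightarrow> 'a poly \<Rightarrow> 'b \<Rightarrow> 'b"
  where "poly_op X f v = (\<Sum>i\<le>degree f. scale (coeff f i) ((X ^^ i) v))"

lemma poly_op_atMost:
  fixes f :: "'a poly"
  assumes "degree f \<le> n"
  shows "poly_op X f v = (\<Sum>i\<le>n. scale (coeff f i) ((X ^^ i) v))"
  unfolding poly_op_def using assms
  by (intro sum.mono_neutral_left) (auto simp: coeff_eq_0)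

lemma poly_op_0 [simp]: "poly_op X 0 v = 0"
  by (simp add: poly_op_def)

lemma poly_op_add: "poly_op X (f + g) v = poly_op X f v + poly_op X g v"
proof -
  let ?n = "max (degree f) (degree g)"
  have "poly_op X (f + g) v = (\<Sum>i\<le>?n. scale (coeff (f + g) i) ((X ^^ i) v))"
    by (rule poly_op_atMost) (simp add: degree_add_le_max)
  also have "\<dots> = poly_op X f v + poly_op X g v"
    by (simp add: poly_op_atMost[of f ?n] poly_op_atMost[of g ?n] scale_left_distrib sum.distrib)
  finally show ?thesis .
qed

lemma poly_op_smult: "poly_op X (smult c f) v = scale c (poly_op X f v)"
  by (subst poly_op_atMost[of _ "degree f"]) (auto simp: degree_smult_le poly_op_def scale_sum_right)

lemma poly_op_monom: "poly_op X (monom c n) v = scale c ((X ^^ n) v)"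
proof -
  have "poly_op X (monom c n) v = (\<Sum>i\<le>n. scale (coeff (monom c n) i) ((X ^^ i) v))"
    by (rule poly_op_atMost) (rule degree_monom_le)
  also have "\<dots> = (\<Sum>i\<in>{n}. scale (coeff (monom c n) i) ((X ^^ i) v))"
    by (intro sum.mono_neutral_right) (auto)
  finally show ?thesis by simp
qed

lemma poly_op_diff: "poly_op X (f - g) v = poly_op X f v - poly_op X g v"
  by (metis add_diff_cancel_right' diff_add_cancel poly_op_add)

text \<open>Horner's rule, the recursion behind the inductions over \<open>f\<close> below.\<close>

lemma poly_op_pCons:
  assumes "Vector_Spaces.linear scale scale X"
  shows "poly_op X (pCons a f) v = scale a v + X (poly_op X f v)"
proof -
  interpret X: Vector_Spaces.linear scale scale X by fact
  have "poly_op X (pCons a f) v = (\<Sum>i\<le>Suc (degree f). scale (coeff (pCons a f) i) ((X ^^ i) v))"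
    by (rule poly_op_atMost) (rule degree_pCons_le)
  then show ?thesis
    by (simp add: sum.atMost_Suc_shift poly_op_def X.sum X.scale del: sum.atMost_Suc)
qed

lemma poly_op_linear:
  assumes "Vector_Spaces.linear scale scale X"
  shows "poly_op X f (u + v) = poly_op X f u + poly_op X f v"
    and "poly_op X f (scale c v) = scale c (poly_op X f v)"
proof -
  interpret X: Vector_Spaces.linear scale scale X by fact
  show "poly_op X f (u + v) = poly_op X f u + poly_op X f v"
    by (induction f) (simp_all add: poly_op_pCons[OF assms] X.add scale_right_distrib)
  show "poly_op X f (scale c v) = scale c (poly_op X f v)"
    by (induction f) (simp_all add: poly_op_pCons[OF assms] X.scale scale_right_distrib mult.commute)
qed

lemma poly_op_mult:
  assumes "Vector_Spaces.linear scale scale X"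
  shows "poly_op X (f * g) v = poly_op X f (poly_op X g v)"
  by (induction f) (simp_all add: poly_op_pCons[OF assms] poly_op_add poly_op_smult)

lemma poly_op_mem:
  assumes "Vector_Spaces.linear scale scale X" "subspace U" "\<forall>u\<in>U. X u \<in> U" "u \<in> U"
  shows "poly_op X f u \<in> U"
  by (induction f) (use assms in \<open>auto simp: poly_op_pCons subspace_0 intro!: subspace_add subspace_scale\<close>)

lemma poly_op_funpow:
  assumes "Vector_Spaces.linear scale scale X"
  shows "poly_op X f ((X ^^ i) v) = (X ^^ i) (poly_op X f v)"
  using poly_op_mult[OF assms, of f "monom 1 i" v] poly_op_mult[OF assms, of "monom 1 i" f v]
  by (simp add: poly_op_monom mult.commute)

lemma funpow_mem: "\<forall>u\<in>U. X u \<in> U \<Longrightarrow> u \<in> U \<Longrightarrow> (X ^^ i) u \<in> U"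
  by (induction i) auto

end

section \<open>Annihilating polynomials modulo an invariant subspace\<close>

locale finite_dimensional_operator = vector_space_operator scale +
  finite_dimensional_vector_space scale Basis
  for scale :: "'a::field \<Rightarrow> 'b::ab_group_add \<Rightarrow> 'b" and Basis
begin

text \<open>\<open>E\<close> is spanned by \<open>U\<close> and the iterates of \<open>v\<close>,
  and \<open>f\<close> is the minimal polynomial of \<open>v\<close> modulo \<open>U\<close>. Its
  degree counts the iterates that are new modulo \<open>U\<close>, whence the exact dimension
  formula.\<close>

lemma ex_cyclic_extension:
  assumes X: "Vector_Spaces.linear scale scale X"
    and U: "subspace U" "\<forall>u\<in>U. X u \<in> U"
    and W: "subspace W" "\<forall>w\<in>W. X w \<in> W" and UW: "U \<subseteq> W"
    and v: "v \<in> W" "v \<notin> U"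
  shows "\<exists>E f. subspace E \<and> (\<forall>u\<in>E. X u \<in> E) \<and> U \<subseteq> E \<and> E \<subseteq> W \<and> v \<in> E \<and> f \<noteq> 0 \<and>
    dim E = dim U + degree f \<and> (\<forall>u\<in>E. poly_op X f u \<in> U)"
proof -
  interpret X: Vector_Spaces.linear scale scale X by fact
  define E where "E k = span (U \<union> (\<lambda>i. (X ^^ i) v) ` {..<k})" for k
  have Xv: "(X ^^ i) v \<in> W" for i
    using funpow_mem[OF W(2) v(1)] .
  have EW: "E k \<subseteq> W" for k
    unfolding E_def using UW Xv by (intro span_minimal W(1)) auto
  have UE: "U \<subseteq> E k" for k
    unfolding E_def by (meson Un_upper1 span_superset subset_trans)
  have E_Suc: "E (Suc k) = span (insert ((X ^^ k) v) (U \<union> (\<lambda>i. (X ^^ i) v) ` {..<k}))" for k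
    by (simp add: E_def lessThan_Suc)
  have dimE: "dim (E n) = dim U + n" if "\<forall>k<n. (X ^^ k) v \<notin> E k" for n
    using that
  proof (induction n)
    case 0
    then show ?case using U(1) by (simp add: E_def)
  next
    case (Suc n)
    then have "dim (E n) = dim U + n" "(X ^^ n) v \<notin> E n" by auto
    then show ?case unfolding E_Suc by (simp add: dim_insert E_def)
  qed
  have ex: "\<exists>k. (X ^^ k) v \<in> E k"
  proof (rule ccontr)
    assume "\<not> ?thesis"
    then have "dim (E (Suc (dim W))) = dim U + Suc (dim W)" using dimE by blast
    then show False using dim_subset[OF EW[of "Suc (dim W)"]] by linarith
  qed
  \<comment> \<open>The first iterate that depends on the earlier ones modulo \<open>U\<close>.
    Minimality fixes the dimension of \<open>E k\<close>, membership makes \<open>E k\<close>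
    invariant.\<close>
  define k where "k = (LEAST k. (X ^^ k) v \<in> E k)"
  have k: "(X ^^ k) v \<in> E k" unfolding k_def using ex by (rule LeastI_ex)
  have min: "\<forall>i<k. (X ^^ i) v \<notin> E i" unfolding k_def using not_less_Least by blast
  have "E 0 = U" using U(1) by (simp add: E_def)
  then have "k \<noteq> 0" using k v(2) by (intro notI) simp
  have gen: "(X ^^ i) v \<in> E k" if "i < k" for i
    unfolding E_def by (rule span_base) (use that in auto)
  have "X e \<in> E k" if "e \<in> E k" for e
  proof -
    have "subspace {e. X e \<in> E k}"
      by (auto intro!: subspaceI simp: X.add X.scale X.zero E_def span_zero span_add span_scale)
    moreover have "X ((X ^^ i) v) \<in> E k" if "i < k" for i
      using gen[of "Suc i"] k that by (cases "Suc i = k") auto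
    then have "U \<union> (\<lambda>i. (X ^^ i) v) ` {..<k} \<subseteq> {e. X e \<in> E k}"
      using U(2) UE by auto
    ultimately show ?thesis using that span_minimal unfolding E_def by blast
  qed
  moreover obtain u g where u: "u \<in> U" and g: "g = 0 \<or> degree g < k" and "(X ^^ k) v = u + poly_op X g v"
  proof -
    \<comment> \<open>\<open>P\<close> contains the generators of \<open>E k\<close>, so that
      \<open>X^k v\<close> takes the form \<open>u + g(X) v\<close> with \<open>g\<close> of degree
      below \<open>k\<close>; then \<open>monom 1 k - g\<close> is monic of degree
      \<open>k\<close>.\<close>
    define P where "P = {u + poly_op X g v | u g. u \<in> U \<and> (g = 0 \<or> degree g < k)}"
    have "subspace P"
    proof (rule subspaceI)
      show "0 \<in> P" unfolding P_def using subspace_0[OF U(1)] by force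
    next
      fix x y assume "x \<in> P" "y \<in> P"
      then obtain u g u' g' where *: "u \<in> U" "g = 0 \<or> degree g < k" "x = u + poly_op X g v"
        "u' \<in> U" "g' = 0 \<or> degree g' < k" "y = u' + poly_op X g' v"
        unfolding P_def by blast
      then have "u + u' \<in> U" "g + g' = 0 \<or> degree (g + g') < k"
          "x + y = (u + u') + poly_op X (g + g') v"
        using subspace_add[OF U(1)] \<open>k \<noteq> 0\<close> by (auto simp: poly_op_add degree_add_less)
      then show "x + y \<in> P" unfolding P_def by blast
    next
      fix c x assume "x \<in> P"
      then obtain u g where *: "u \<in> U" "g = 0 \<or> degree g < k" "x = u + poly_op X g v"
        unfolding P_def by blast
      then have "scale c u \<in> U" "smult c g = 0 \<or> degree (smult c g) < k"
          "scale c x = scale c u + poly_op X (smult c g) v"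
        using subspace_scale[OF U(1)] by (auto simp: poly_op_smult scale_right_distrib)
      then show "scale c x \<in> P" unfolding P_def by blast
    qed
    moreover have "U \<subseteq> P"
    proof
      fix u assume "u \<in> U"
      then have "u = u + poly_op X 0 v" by simp
      then show "u \<in> P" unfolding P_def using \<open>u \<in> U\<close> by blast
    qed
    moreover have "(X ^^ i) v \<in> P" if "i < k" for i
    proof -
      have "(X ^^ i) v = 0 + poly_op X (monom 1 i) v" by (simp add: poly_op_monom)
      moreover have "degree (monom (1::'a) i) < k" using that by (simp add: degree_monom_eq)
      ultimately show ?thesis unfolding P_def using subspace_0[OF U(1)] by blast
    qed
    ultimately have "E k \<subseteq> P" unfolding E_def by (intro span_minimal) auto
    then show ?thesis using k that unfolding P_def by blast
  qed
  moreover define f where "f = monom 1 k - g"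
  ultimately have fv: "poly_op X f v \<in> U" by (simp add: poly_op_diff poly_op_monom)
  have "coeff f k = 1" using g by (auto simp: f_def coeff_eq_0)
  then have "f \<noteq> 0" by auto
  have "degree f \<le> k"
    unfolding f_def using g by (intro degree_diff_le) (auto simp: degree_monom_le)
  with \<open>coeff f k = 1\<close> have degf: "degree f = k" by (metis le_antisym le_degree one_neq_zero)
  \<comment> \<open>Generators suffice, and \<open>f(X)\<close> commutes with the powers of
    \<open>X\<close>.\<close>
  have "poly_op X f e \<in> U" if "e \<in> E k" for e
  proof -
    have "subspace {e. poly_op X f e \<in> U}"
      using poly_op_linear[OF X] U(1) poly_op_mem[OF X U subspace_0[OF U(1)]]
      by (auto intro!: subspaceI simp: subspace_add subspace_scale)
    moreover have "U \<union> (\<lambda>i. (X ^^ i) v) ` {..<k} \<subseteq> {e. poly_op X f e \<in> U}"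
      using poly_op_mem[OF X U] fv funpow_mem[OF U(2)] by (auto simp: poly_op_funpow[OF X])
    ultimately show ?thesis using that span_minimal unfolding E_def by blast
  qed
  moreover have "v \<in> E k" using gen[of 0] \<open>k \<noteq> 0\<close> by simp
  moreover have "subspace (E k)" by (simp add: E_def)
  moreover have "\<And>e. e \<in> E k \<Longrightarrow> X e \<in> E k" by fact
  ultimately show ?thesis
    using UE EW \<open>f \<noteq> 0\<close> dimE[OF min] degf by (intro exI[of _ "E k"] exI[of _ f]) simp
qed

text \<open>Climb from \<open>U\<close> to \<open>W\<close> by cyclic extensions and multiply their
  annihilators. Degrees add up as dimensions do; the resulting bound is what is later compared with
  the characteristic.\<close>

lemma ex_annihilating_poly:
  assumes X: "Vector_Spaces.linear scale scale X"
    and W: "subspace W" "\<forall>w\<in>W. X w \<in> W"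
    and U: "subspace U" "\<forall>u\<in>U. X u \<in> U" "U \<subseteq> W"
  shows "\<exists>f. f \<noteq> 0 \<and> degree f \<le> dim W - dim U \<and> (\<forall>w\<in>W. poly_op X f w \<in> U)"
  using U
proof (induction "dim W - dim U" arbitrary: U rule: less_induct)
  case less
  show ?case
  proof (cases "U = W")
    case True
    then show ?thesis using poly_op_mem[OF X W] by (intro exI[of _ 1]) auto
  next
    case False
    then obtain v where v: "v \<in> W" "v \<notin> U" using less.prems by blast
    obtain E f where E: "subspace E" "\<forall>u\<in>E. X u \<in> E" "U \<subseteq> E" "E \<subseteq> W" "v \<in> E" and
      f: "f \<noteq> 0" "dim E = dim U + degree f" "\<forall>u\<in>E. poly_op X f u \<in> U"
      using ex_cyclic_extension[OF X less.prems(1,2) W less.prems(3) v] by blast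
    have "dim U < dim E" using dim_psubset E v less.prems(1) by (metis psubsetI span_eq_iff)
    moreover have "dim E \<le> dim W" using dim_subset E by blast
    ultimately obtain g where g: "g \<noteq> 0" "degree g \<le> dim W - dim E" "\<forall>w\<in>W. poly_op X g w \<in> E"
      using less.hyps[of E] E by force
    have "degree (f * g) \<le> dim W - dim U"
      using g f \<open>dim E \<le> dim W\<close> by (simp add: degree_mult_eq)
    \<comment> \<open>\<open>g(X)\<close> maps \<open>W\<close> into \<open>E\<close>, and
      \<open>f(X)\<close> maps \<open>E\<close> into \<open>U\<close>.\<close>
    then show ?thesis using f g by (intro exI[of _ "f * g"]) (auto simp: poly_op_mult[OF X])
  qed
qed

end

section \<open>Nilpotency of the derivative of an operator\<close>

context vector_space_operator
begin

text \<open>\<open>Y\<close> and \<open>Z\<close> are the commutators \<open>[D, X]\<close> and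
  \<open>[D, Y]\<close>, while commuting is meant modulo \<open>U\<close>. In the application,
  \<open>X\<close>, \<open>Y\<close>, \<open>Z\<close> are \<open>ad\<close> of \<open>x\<close>,
  \<open>\<delta> x\<close>, \<open>\<delta> (\<delta> x)\<close>, and \<open>D\<close> is
  \<open>\<delta>\<close>.\<close>

context
  fixes X Y Z D :: "'b \<Rightarrow> 'b" and W U :: "'b set"
  assumes X: "Vector_Spaces.linear scale scale X" and Y: "Vector_Spaces.linear scale scale Y"
    and D: "Vector_Spaces.linear scale scale D"
    and U: "subspace U" and UW: "U \<subseteq> W" and W: "subspace W"
    and XU: "\<forall>u\<in>U. X u \<in> U" and YU: "\<forall>u\<in>U. Y u \<in> U" and DU: "\<forall>u\<in>U. D u \<in> U"
    and XW: "\<forall>w\<in>W. X w \<in> W" and YW: "\<forall>w\<in>W. Y w \<in> W" and ZW: "\<forall>w\<in>W. Z w \<in> W"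
    and DW: "\<forall>w\<in>W. D w \<in> W"
    and DX: "\<And>w. D (X w) = X (D w) + Y w" and DY: "\<And>w. D (Y w) = Y (D w) + Z w"
    and XY: "\<forall>w\<in>W. X (Y w) - Y (X w) \<in> U" and YZ: "\<forall>w\<in>W. Y (Z w) - Z (Y w) \<in> U"
begin

interpretation X: Vector_Spaces.linear scale scale X by (rule X)
interpretation Y: Vector_Spaces.linear scale scale Y by (rule Y)
interpretation D: Vector_Spaces.linear scale scale D by (rule D)

lemma mem_iff_of_diff_mem: "x - y \<in> U \<Longrightarrow> x \<in> U \<longleftrightarrow> y \<in> U"
  using subspace_diff[OF U, of x "x - y"] subspace_add[OF U, of y "x - y"] by auto

lemma commute_poly_op: "w \<in> W \<Longrightarrow> poly_op X f (Y w) - Y (poly_op X f w) \<in> U"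
proof (induction f)
  case 0
  then show ?case using subspace_0[OF U] by (simp add: Y.zero)
next
  case (pCons a f)
  let ?v = "poly_op X f w"
  have "X (poly_op X f (Y w) - Y ?v) + (X (Y ?v) - Y (X ?v)) \<in> U"
    using pCons XU XY poly_op_mem[OF X W XW] subspace_add[OF U] by blast
  then show ?case
    by (simp add: poly_op_pCons[OF X] Y.add Y.scale X.diff)
qed

text \<open>The chain rule \<open>[D, f(X)] = f'(X) Y\<close> modulo \<open>U\<close>, by the
  product rule along Horner's scheme. There \<open>Y\<close> appears to the left of
  \<open>f(X)\<close>; \<open>commute_poly_op\<close> moves it to the right.\<close>

lemma derivation_poly_op:
  "w \<in> W \<Longrightarrow> D (poly_op X f w) - (poly_op X f (D w) + poly_op X (pderiv f) (Y w)) \<in> U"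
proof (induction f)
  case 0
  then show ?case using subspace_0[OF U] by (simp add: D.zero)
next
  case (pCons a f)
  let ?v = "poly_op X f w"
  have "X (D ?v - (poly_op X f (D w) + poly_op X (pderiv f) (Y w))) - (poly_op X f (Y w) - Y ?v) \<in> U"
    using pCons XU commute_poly_op subspace_diff[OF U] by blast
  moreover have "D (poly_op X (pCons a f) w) -
      (poly_op X (pCons a f) (D w) + poly_op X (pderiv (pCons a f)) (Y w)) =
    X (D ?v - (poly_op X f (D w) + poly_op X (pderiv f) (Y w))) - (poly_op X f (Y w) - Y ?v)"
    by (simp add: poly_op_pCons[OF X] pderiv_pCons poly_op_add D.add D.scale DX X.add X.diff
        algebra_simps)
  ultimately show ?case by (simp only:)
qed

lemma commute_funpow: "w \<in> W \<Longrightarrow> (Y ^^ k) (Z w) - Z ((Y ^^ k) w) \<in> U"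
proof (induction k arbitrary: w)
  case 0
  then show ?case using subspace_0[OF U] by simp
next
  case (Suc k)
  have "(Y ^^ k) (Y (Z w) - Z (Y w)) \<in> U"
    using Suc.prems YZ funpow_mem[OF YU] by blast
  moreover have "(Y ^^ k) (x - y) = (Y ^^ k) x - (Y ^^ k) y" for x y
    by (induction k) (simp_all add: Y.diff)
  moreover have "(Y ^^ k) (Z (Y w)) - Z ((Y ^^ k) (Y w)) \<in> U"
    using Suc YW by blast
  ultimately show ?case
    using subspace_add[OF U] by (fastforce simp: funpow_Suc_right simp del: funpow.simps)
qed

text \<open>Multiplying \<open>D (Y\<^sup>k w)\<close> by one further \<open>Y\<close> brings the term containing \<open>Z = [D, Y]\<close> into the
  form \<open>Y\<^sup>k Z w\<close>.\<close>

lemma derivation_funpow: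
  "w \<in> W \<Longrightarrow> D ((Y ^^ k) (Y w)) - ((Y ^^ k) (D (Y w)) + scale (of_nat k) ((Y ^^ k) (Z w))) \<in> U"
proof (induction k)
  case 0
  then show ?case using subspace_0[OF U] by simp
next
  case (Suc k)
  let ?r = "D ((Y ^^ k) (Y w)) - ((Y ^^ k) (D (Y w)) + scale (of_nat k) ((Y ^^ k) (Z w)))"
  have "Y ?r \<in> U" using Suc YU by blast
  moreover have "(Y ^^ Suc k) (Z w) - Z ((Y ^^ Suc k) w) \<in> U"
    using Suc.prems by (rule commute_funpow)
  ultimately have "Y ?r - ((Y ^^ Suc k) (Z w) - Z ((Y ^^ Suc k) w)) \<in> U"
    by (rule subspace_diff[OF U])
  moreover have "(Y ^^ k) (Y w) = (Y ^^ Suc k) w"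
    by (simp add: funpow_swap1)
  ultimately show ?case
    by (simp add: DY Y.diff Y.add Y.scale scale_left_distrib algebra_simps)
qed

text \<open>Apply \<open>D\<close> to \<open>f(X) Y^(k+1) w\<close>. In the chain rule,
  \<open>f(X) D Y^(k+1) w\<close> lies in \<open>U\<close>, because \<open>D Y^(k+1) w\<close> is
  congruent to \<open>Y^k (D Y w + k Z w)\<close>; the other term is \<open>f'(X) Y^(k+2) w\<close>.
  One extra \<open>Y\<close> stems from \<open>derivation_funpow\<close>, the other from
  \<open>[D, X] = Y\<close>.\<close>

lemma poly_op_pderiv_mem:
  assumes ann: "\<forall>w\<in>W. poly_op X f ((Y ^^ k) w) \<in> U"
  shows "\<forall>w\<in>W. poly_op X (pderiv f) ((Y ^^ (k + 2)) w) \<in> U"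
proof
  fix w assume w: "w \<in> W"
  let ?P = "poly_op X f" and ?v = "(Y ^^ k) (Y w)"
  let ?r = "D ?v - ((Y ^^ k) (D (Y w)) + scale (of_nat k) ((Y ^^ k) (Z w)))"
  have v: "?v \<in> W" using w YW funpow_mem[OF YW] by blast
  have "?P ((Y ^^ k) (D (Y w))) \<in> U" "scale (of_nat k) (?P ((Y ^^ k) (Z w))) \<in> U"
    using ann w DW YW ZW subspace_scale[OF U] by blast+
  moreover have "?P ?r \<in> U" using poly_op_mem[OF X U XU derivation_funpow[OF w]] .
  ultimately have "?P ?r + (?P ((Y ^^ k) (D (Y w))) + scale (of_nat k) (?P ((Y ^^ k) (Z w)))) \<in> U"
    using subspace_add[OF U] by blast
  moreover have "?P (D ?v) = ?P (?r + ((Y ^^ k) (D (Y w)) + scale (of_nat k) ((Y ^^ k) (Z w))))"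
    by simp
  ultimately have "?P (D ?v) \<in> U"
    by (simp only: poly_op_linear[OF X])
  moreover have "D (?P ?v) \<in> U" using ann w YW DU by blast
  ultimately have "poly_op X (pderiv f) (Y ?v) \<in> U"
    using derivation_poly_op[OF v, of f] subspace_diff[OF U]
    by (metis add_diff_cancel_left' mem_iff_of_diff_mem)
  then show "poly_op X (pderiv f) ((Y ^^ (k + 2)) w) \<in> U"
    by (simp add: funpow_swap1)
qed

text \<open>Differentiating a nonconstant \<open>f\<close> lowers the degree but never yields
  \<open>0\<close>: the leading coefficient is multiplied by the degree, which is nonzero in the
  field. In the end a nonzero constant is divided out.\<close>

lemma funpow_mem_if_annihilated:
  assumes "f \<noteq> 0" "\<And>i. 0 < i \<Longrightarrow> i \<le> degree f \<Longrightarrow> (of_nat i :: 'a) \<noteq> 0"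
    and "\<forall>w\<in>W. poly_op X f ((Y ^^ k) w) \<in> U"
  shows "\<exists>n. \<forall>w\<in>W. (Y ^^ n) w \<in> U"
  using assms
proof (induction "degree f" arbitrary: f k rule: less_induct)
  case less
  show ?case
  proof (cases "degree f")
    case 0
    then obtain c where c: "f = [:c:]" using degree_eq_zeroE by blast
    then have "c \<noteq> 0" using less.prems(1) by simp
    have "scale c ((Y ^^ k) w) \<in> U" if "w \<in> W" for w
      using less.prems(3) that by (simp add: c poly_op_pCons[OF X] X.zero)
    then have "scale (inverse c) (scale c ((Y ^^ k) w)) \<in> U" if "w \<in> W" for w
      using that subspace_scale[OF U] by blast
    then show ?thesis using \<open>c \<noteq> 0\<close> by auto
  next
    case (Suc m)
    have "coeff (pderiv f) m = of_nat (Suc m) * lead_coeff f"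
      by (simp add: coeff_pderiv Suc)
    then have nz: "pderiv f \<noteq> 0"
      using less.prems(1) less.prems(2)[of "Suc m"] Suc by (metis coeff_0 le_refl leading_coeff_0_iff mult_eq_0_iff zero_less_Suc)
    have "degree (pderiv f) \<le> m"
      by (rule degree_le) (auto simp: coeff_pderiv Suc coeff_eq_0)
    then show ?thesis
      using less.hyps[of "pderiv f" "k + 2"] less.prems(2) nz poly_op_pderiv_mem[OF less.prems(3)] Suc
      by simp
  qed
qed

end
end


section \<open>Ideals stable under a derivation\<close>

locale lie_algebra_derivation = lie_algebra scale bracket + finite_dimensional_operator scale Basis
  for scale :: "'a::field \<Rightarrow> 'b::ab_group_add \<Rightarrow> 'b"
    and bracket :: "'b \<Rightarrow> 'b \<Rightarrow> 'b" and Basis :: "'b set" +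
  fixes d :: "'b \<Rightarrow> 'b"
  assumes derivation_d: "derivation d"
    and finite_order_d: "finite_order d"
begin

definition d_ideal :: "'b set \<Rightarrow> bool"
  where "d_ideal I \<longleftrightarrow> subspace I \<and> (\<forall>x. \<forall>y\<in>I. bracket x y \<in> I) \<and> (\<forall>y\<in>I. d y \<in> I)"

lemma linear_d: "Vector_Spaces.linear scale scale d"
  using derivation_d by (simp add: derivation_def)

interpretation d: Vector_Spaces.linear scale scale d
  by (rule linear_d)

lemma d_bracket: "d (bracket x y) = bracket (d x) y + bracket x (d y)"
  using derivation_d by (simp add: derivation_def)

lemma linear_ad: "Vector_Spaces.linear scale scale (bracket x)"
  by unfold_locales (simp_all add: bracket_add_right bracket_scale_right)

lemma bracket_zero_right [simp]: "bracket x 0 = 0"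
  using bracket_add_right[of x 0 0] by simp

lemma bracket_swap: "bracket x y = - bracket y x"
proof -
  have "0 = bracket (x + y) (x + y)" by (simp only: bracket_self)
  also have "\<dots> = bracket x y + bracket y x"
    by (simp add: bracket_add_left bracket_add_right bracket_self[of x] bracket_self[of y])
  finally show ?thesis by (simp add: eq_neg_iff_add_eq_0)
qed

lemma bracket_minus_right: "bracket x (- y) = - bracket x y"
  using bracket_scale_right[of x "-1" y] by simp

text \<open>Jacobi as a Leibniz rule for \<open>ad x\<close>; equally,
  \<open>[ad x, ad y] = ad [x, y]\<close>.\<close>

lemma bracket_leibniz: "bracket x (bracket y z) = bracket (bracket x y) z + bracket y (bracket x z)"
  using jacobi[of x y z] bracket_swap[of z "bracket x y"] bracket_swap[of z x]
  by (simp add: bracket_minus_right algebra_simps)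

text \<open>Finite order makes the inverse of \<open>d\<close> a power of \<open>d\<close>, so it
  preserves whatever \<open>d\<close> preserves.\<close>

lemma d_surj_on_ideal:
  assumes "d_ideal I" "y \<in> I"
  obtains x where "x \<in> I" "d x = y"
proof -
  obtain n where "n \<ge> 1" "d ^^ n = id"
    using finite_order_d by (auto simp: finite_order_def)
  then obtain m where "d ((d ^^ m) y) = y"
    by (metis Suc_diff_1 funpow.simps(2) less_eq_Suc_le One_nat_def comp_apply id_apply)
  moreover have "(d ^^ m) y \<in> I"
    using assms funpow_mem[of I d y] by (auto simp: d_ideal_def)
  ultimately show ?thesis using that by blast
qed

lemma d_ideal_span:
  assumes "\<And>x y. y \<in> S \<Longrightarrow> bracket x y \<in> span S" and "\<And>y. y \<in> S \<Longrightarrow> d y \<in> span S"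
  shows "d_ideal (span S)"
proof -
  have "bracket x y \<in> span S" if "y \<in> span S" for x y
    using that
    by (induction rule: span_induct_alt)
      (auto simp: bracket_add_right bracket_scale_right span_zero intro!: span_add span_scale assms(1))
  moreover have "d y \<in> span S" if "y \<in> span S" for y
    using that
    by (induction rule: span_induct_alt)
      (auto simp: d.add d.scale d.zero span_zero intro!: span_add span_scale assms(2))
  ultimately show ?thesis by (simp add: d_ideal_def)
qed

section \<open>The stable ideals \<open>[A, W] + U\<close>\<close>

definition bracket_extend :: "'b set \<Rightarrow> 'b set \<Rightarrow> 'b set \<Rightarrow> 'b set"
  where "bracket_extend A W U = span (U \<union> {bracket x w | x w. x \<in> A \<and> w \<in> W})"

lemma bracket_in_extend: "x \<in> A \<Longrightarrow> w \<in> W \<Longrightarrow> bracket x w \<in> bracket_extend A W U"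
  unfolding bracket_extend_def by (rule span_base) blast

lemma subset_extend: "U \<subseteq> bracket_extend A W U"
  unfolding bracket_extend_def using span_superset by blast

lemma bracket_extend_least:
  "subspace Z \<Longrightarrow> U \<subseteq> Z \<Longrightarrow> (\<And>x w. x \<in> A \<Longrightarrow> w \<in> W \<Longrightarrow> bracket x w \<in> Z) \<Longrightarrow> bracket_extend A W U \<subseteq> Z"
  unfolding bracket_extend_def by (intro span_minimal) auto

text \<open>Both \<open>ad z\<close> and \<open>d\<close> obey a Leibniz rule, so they send a
  generator \<open>bracket x w\<close> to a sum of two such generators.\<close>

lemma d_ideal_extend:
  assumes A: "d_ideal A" and W: "d_ideal W" and U: "d_ideal U"
  shows "d_ideal (bracket_extend A W U)"
  unfolding bracket_extend_def
proof (rule d_ideal_span; fold bracket_extend_def)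
  have sub: "subspace (bracket_extend A W U)" by (simp add: bracket_extend_def)
  fix y assume y: "y \<in> U \<union> {bracket x w | x w. x \<in> A \<and> w \<in> W}"
  show "bracket z y \<in> bracket_extend A W U" for z
  proof (cases "y \<in> U")
    case True
    then show ?thesis using U subset_extend[of U A W] unfolding d_ideal_def by blast
  next
    case False
    then obtain x w where *: "x \<in> A" "w \<in> W" "y = bracket x w" using y by blast
    have "bracket z x \<in> A" "bracket z w \<in> W" using * A W by (auto simp: d_ideal_def)
    then show ?thesis
      unfolding *(3) bracket_leibniz[of z] using *
      by (intro subspace_add[OF sub] bracket_in_extend)
  qed
  show "d y \<in> bracket_extend A W U"
  proof (cases "y \<in> U")
    case True
    then show ?thesis using U subset_extend[of U A W] unfolding d_ideal_def by blast
  next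
    case False
    then obtain x w where *: "x \<in> A" "w \<in> W" "y = bracket x w" using y by blast
    have "d x \<in> A" "d w \<in> W" using * A W by (auto simp: d_ideal_def)
    then show ?thesis
      unfolding *(3) d_bracket using *
      by (intro subspace_add[OF sub] bracket_in_extend)
  qed
qed

lemma d_ideal_bracket_span:
  assumes "d_ideal A" "d_ideal W"
  shows "d_ideal (bracket_span A W)"
proof -
  have "d_ideal {0}" by (auto simp: d_ideal_def d.zero)
  moreover have "bracket_span A W = bracket_extend A W {0}"
    by (simp add: bracket_span_def bracket_extend_def)
  ultimately show ?thesis using assms d_ideal_extend by simp
qed

lemma d_ideal_UNIV: "d_ideal UNIV"
  by (simp add: d_ideal_def)

lemma d_ideal_derived_series: "d_ideal (derived_series i)"
  by (induction i) (simp_all add: d_ideal_UNIV d_ideal_bracket_span)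

lemma d_ideal_lower_central_series: "d_ideal (lower_central_series i)"
  by (induction i) (simp_all add: d_ideal_UNIV d_ideal_bracket_span)

lemma bracket_in_bracket_span: "x \<in> A \<Longrightarrow> w \<in> W \<Longrightarrow> bracket x w \<in> bracket_span A W"
  unfolding bracket_span_def by (rule span_base) blast

lemma derived_series_Suc_subset: "derived_series (Suc i) \<subseteq> derived_series i"
proof -
  have "{bracket x y | x y. x \<in> derived_series i \<and> y \<in> derived_series i} \<subseteq> derived_series i"
    and "subspace (derived_series i)"
    using d_ideal_derived_series[of i] by (auto simp: d_ideal_def)
  then show ?thesis by (simp add: bracket_span_def span_minimal)
qed

text \<open>With \<open>d x = y\<close>, the operator \<open>ad y\<close> is the commutator of
  \<open>d\<close> and \<open>ad x\<close>, and \<open>comm\<close> makes the operators of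
  \<open>A\<close> commute on \<open>W / U\<close>. The annihilating polynomial of
  \<open>ad x\<close> there has degree small enough for \<open>char\<close>.\<close>

lemma ad_nilpotent_mod:
  assumes A: "d_ideal A" and W: "d_ideal W" and U: "d_ideal U" and UW: "U \<subseteq> W"
    and comm: "\<And>x y w. x \<in> A \<Longrightarrow> y \<in> A \<Longrightarrow> w \<in> W \<Longrightarrow> bracket (bracket x y) w \<in> U"
    and char: "\<And>k. 0 < k \<Longrightarrow> k \<le> dim W - dim U \<Longrightarrow> (of_nat k :: 'a) \<noteq> 0"
    and y: "y \<in> A"
  shows "\<exists>n. \<forall>w\<in>W. (bracket y ^^ n) w \<in> U"
proof -
  obtain x where x: "x \<in> A" "d x = y" using d_surj_on_ideal[OF A y] .
  have dy: "d y \<in> A" using A y by (simp add: d_ideal_def)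
  have sub: "subspace W" "subspace U" using W U by (simp_all add: d_ideal_def)
  have stable: "\<forall>w\<in>W. bracket z w \<in> W" "\<forall>u\<in>U. bracket z u \<in> U" for z
    using W U by (simp_all add: d_ideal_def)
  have dstable: "\<forall>w\<in>W. d w \<in> W" "\<forall>u\<in>U. d u \<in> U"
    using W U by (simp_all add: d_ideal_def)
  obtain f where f: "f \<noteq> 0" "degree f \<le> dim W - dim U" "\<forall>w\<in>W. poly_op (bracket x) f w \<in> U"
    using ex_annihilating_poly[OF linear_ad sub(1) stable(1) sub(2) stable(2) UW] by blast
  show ?thesis
  proof (rule funpow_mem_if_annihilated[where D = d and X = "bracket x" and Y = "bracket y"
        and Z = "bracket (d y)" and k = 0 and f = f])
    show "\<forall>w\<in>W. bracket x (bracket y w) - bracket y (bracket x w) \<in> U"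
      using comm[OF x(1) y] by (simp add: bracket_leibniz[of x])
    show "\<forall>w\<in>W. bracket y (bracket (d y) w) - bracket (d y) (bracket y w) \<in> U"
      using comm[OF y dy] by (simp add: bracket_leibniz[of y])
    show "d (bracket x w) = bracket x (d w) + bracket y w"
      and "d (bracket y w) = bracket y (d w) + bracket (d y) w" for w
      by (simp_all add: d_bracket x(2) add.commute)
    show "(of_nat i :: 'a) \<noteq> 0" if "0 < i" "i \<le> degree f" for i
      using char that f(2) by simp
    show "\<forall>w\<in>W. poly_op (bracket x) f ((bracket y ^^ 0) w) \<in> U" using f(3) by simp
  qed (use linear_ad linear_d sub UW stable dstable f(1) in blast)+
qed

text \<open>As in Engel's theorem: a maximal proper \<open>A\<close>-stable \<open>Z\<close> above
  \<open>U\<close> absorbs \<open>[A, W]\<close>, since otherwise some \<open>s\<close> in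
  \<open>A\<close> would act on \<open>W / Z\<close> both injectively and nilpotently.\<close>

lemma bracket_extend_proper_if_commuting:
  assumes A: "d_ideal A" and W: "d_ideal W" and U: "d_ideal U" and UW: "U \<subset> W"
    and comm: "\<And>x y w. x \<in> A \<Longrightarrow> y \<in> A \<Longrightarrow> w \<in> W \<Longrightarrow> bracket (bracket x y) w \<in> U"
    and char: "\<And>k. 0 < k \<Longrightarrow> k \<le> dim W - dim U \<Longrightarrow> (of_nat k :: 'a) \<noteq> 0"
  shows "bracket_extend A W U \<subset> W"
proof -
  define P where "P Z \<longleftrightarrow> subspace Z \<and> U \<subseteq> Z \<and> Z \<subset> W \<and> (\<forall>x\<in>A. \<forall>z\<in>Z. bracket x z \<in> Z)" for Z
  have "P U" using U UW by (auto simp: P_def d_ideal_def)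
  moreover have "\<forall>Z. P Z \<longrightarrow> dim Z < Suc (dim W)"
    by (auto simp: P_def less_Suc_eq_le intro: dim_subset)
  ultimately obtain Z where Z: "P Z" and max: "\<And>Z'. P Z' \<Longrightarrow> dim Z' \<le> dim Z"
    using ex_has_greatest_nat[of P U dim "Suc (dim W)"] by blast
  have sub: "subspace W" "subspace Z" using W Z by (simp_all add: d_ideal_def P_def)
  have "bracket s w \<in> Z" if s: "s \<in> A" and w: "w \<in> W" for s w
  proof (rule ccontr)
    \<comment> \<open>The preimage of \<open>Z\<close> under \<open>ad s\<close>. It is
      \<open>A\<close>-stable because \<open>[ad s, ad t] = ad [s, t]\<close> maps \<open>W\<close>
      into \<open>U\<close>; being proper, it equals \<open>Z\<close> by maximality.\<close>
    define Z' where "Z' = {w \<in> W. bracket s w \<in> Z}"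
    assume "bracket s w \<notin> Z"
    then have "Z' \<noteq> W" using w by (auto simp: Z'_def)
    have ZZ': "Z \<subseteq> Z'" using Z s by (auto simp: P_def Z'_def)
    have "bracket t z \<in> Z'" if t: "t \<in> A" and z: "z \<in> Z'" for t z
    proof -
      have "bracket (bracket s t) z \<in> Z" "bracket t (bracket s z) \<in> Z"
        using comm[OF s t] z t Z by (auto simp: Z'_def P_def)
      then have "bracket s (bracket t z) \<in> Z"
        unfolding bracket_leibniz[of s] by (rule subspace_add[OF sub(2)])
      then show ?thesis using z W by (auto simp: Z'_def d_ideal_def)
    qed
    moreover have "subspace Z'"
      using sub unfolding Z'_def
      by (auto intro!: subspaceI simp: subspace_0 subspace_add subspace_scale bracket_add_right
          bracket_scale_right)
    ultimately have "P Z'" using Z ZZ' \<open>Z' \<noteq> W\<close> by (auto simp: P_def Z'_def)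
    then have "Z' = Z"
      using subspace_dim_equal[OF sub(2) \<open>subspace Z'\<close> ZZ'] max by simp
    \<comment> \<open>With \<open>Z' = Z\<close>, a power of \<open>ad s\<close> can be undone one
      factor at a time.\<close>
    have descend: "(bracket s ^^ n) v \<in> Z \<Longrightarrow> v \<in> W \<Longrightarrow> v \<in> Z" for n v
    proof (induction n arbitrary: v)
      case 0
      then show ?case by simp
    next
      case (Suc n)
      have "bracket s v \<in> Z"
        using Suc W by (auto simp: funpow_swap1 d_ideal_def)
      then show ?case using Suc.prems \<open>Z' = Z\<close> by (auto simp: Z'_def)
    qed
    obtain n where "\<forall>w\<in>W. (bracket s ^^ n) w \<in> U"
      using ad_nilpotent_mod[OF A W U _ comm char s] UW by blast
    then have "W \<subseteq> Z" using descend Z by (auto simp: P_def)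
    then show False using Z by (auto simp: P_def)
  qed
  then have "bracket_extend A W U \<subseteq> Z"
    using Z by (intro bracket_extend_least) (auto simp: P_def)
  then show ?thesis using Z by (auto simp: P_def)
qed

text \<open>Downward induction from \<open>j = c\<close>, where by \<open>sec\<close> nothing is
  added to \<open>U\<close>. In the step, passing to the larger \<open>U'\<close> shrinks the
  quotient, so \<open>char\<close> still applies, and it can only enlarge the ideal to be shown
  proper.\<close>

lemma bracket_extend_lower_central_proper:
  assumes sec: "\<And>x w. x \<in> lower_central_series c \<Longrightarrow> w \<in> V \<Longrightarrow> bracket x w \<in> V'"
    and char: "\<And>k. 0 < k \<Longrightarrow> k \<le> dim V - dim V' \<Longrightarrow> (of_nat k :: 'a) \<noteq> 0"
    and "j \<le> c"
  shows "d_ideal W \<Longrightarrow> d_ideal U \<Longrightarrow> V' \<subseteq> U \<Longrightarrow> U \<subset> W \<Longrightarrow> W \<subseteq> V \<Longrightarrow>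
    bracket_extend (lower_central_series j) W U \<subset> W"
  using \<open>j \<le> c\<close>
proof (induction j arbitrary: U rule: inc_induct)
  case base
  have "bracket_extend (lower_central_series c) W U \<subseteq> U"
    using base sec by (intro bracket_extend_least) (auto simp: d_ideal_def)
  then show ?case using base by blast
next
  case (step j)
  let ?A = "lower_central_series j"
  define U' where "U' = bracket_extend (lower_central_series (Suc j)) W U"
  have U': "d_ideal U'"
    unfolding U'_def using step.prems d_ideal_lower_central_series by (intro d_ideal_extend)
  have UU': "U \<subseteq> U'" unfolding U'_def by (rule subset_extend)
  have U'W: "U' \<subset> W" unfolding U'_def using step.IH step.prems by blast
  have "bracket_extend ?A W U' \<subset> W"
  proof (rule bracket_extend_proper_if_commuting[OF d_ideal_lower_central_series step.prems(1) U' U'W])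
    fix x y w assume "x \<in> ?A" "y \<in> ?A" "w \<in> W"
    then show "bracket (bracket x y) w \<in> U'"
      unfolding U'_def by (intro bracket_in_extend) (auto intro: bracket_in_bracket_span)
  next
    fix k :: nat assume "0 < k" "k \<le> dim W - dim U'"
    moreover have "dim W \<le> dim V" "dim V' \<le> dim U'"
      using dim_subset[OF \<open>W \<subseteq> V\<close>] dim_subset[of V' U'] \<open>V' \<subseteq> U\<close> UU' by simp_all
    ultimately show "(of_nat k :: 'a) \<noteq> 0" using char by simp
  qed
  moreover have "bracket_extend ?A W U \<subseteq> bracket_extend ?A W U'"
    unfolding bracket_extend_def using UU' by (intro span_mono) auto
  ultimately show ?case by blast
qed

text \<open>In the step, an ideal \<open>W\<close> descends from \<open>?V\<close> to
  \<open>?V'\<close>: while \<open>W\<close> differs from \<open>?V'\<close>, the ideal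
  \<open>[L, W] + ?V'\<close> is strictly smaller and contains the next term of the lower central
  series.\<close>

lemma lower_central_series_subset_derived:
  assumes char: "\<And>i k. 0 < k \<Longrightarrow> k \<le> dim (derived_series i) - dim (derived_series (Suc i)) \<Longrightarrow>
    (of_nat k :: 'a) \<noteq> 0"
  shows "\<exists>c. lower_central_series c \<subseteq> derived_series i"
proof (induction i)
  case 0
  then show ?case by simp
next
  case (Suc i)
  let ?V = "derived_series i" and ?V' = "derived_series (Suc i)"
  obtain c where c: "lower_central_series c \<subseteq> ?V" using Suc by blast
  have descend: "\<exists>c. lower_central_series c \<subseteq> ?V'"
    if "d_ideal W" "?V' \<subseteq> W" "W \<subseteq> ?V" "lower_central_series a \<subseteq> W" for W a
    using that
  proof (induction "dim W" arbitrary: W a rule: less_induct)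
    case less
    show ?case
    proof (cases "W = ?V'")
      case True
      then show ?thesis using less.prems by blast
    next
      case False
      let ?W = "bracket_extend UNIV W ?V'"
      have "bracket x w \<in> ?V'" if "x \<in> lower_central_series c" "w \<in> ?V" for x w
        using that c by (auto intro: bracket_in_bracket_span)
      then have "bracket_extend (lower_central_series 0) W ?V' \<subset> W"
        using less.prems False d_ideal_derived_series[of "Suc i"]
        by (intro bracket_extend_lower_central_proper[where V = ?V and V' = ?V' and c = c] char) blast+
      then have psub: "?W \<subset> W" by simp
      have W': "d_ideal ?W"
        using less.prems d_ideal_derived_series d_ideal_UNIV by (intro d_ideal_extend)
      have "span ?W \<subset> span W"
        using psub W' less.prems by (simp add: d_ideal_def span_eq_iff[THEN iffD2])
      then have "dim ?W < dim W" by (rule dim_psubset)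
      moreover have "lower_central_series (Suc a) \<subseteq> ?W"
        using less.prems(4) by (auto simp: bracket_span_def bracket_extend_def intro!: span_mono)
      ultimately show ?thesis
        using less.hyps[of ?W "Suc a"] W' psub less.prems subset_extend by blast
    qed
  qed
  show ?case using descend[OF d_ideal_derived_series derived_series_Suc_subset subset_refl c] .
qed

end

theorem theorem1p1:
  fixes scale :: "'a::field \<Rightarrow> 'b::ab_group_add \<Rightarrow> 'b"
    and bracket :: "'b \<Rightarrow> 'b \<Rightarrow> 'b"
    and p :: nat
  assumes "lie_algebra scale bracket"
    and "\<exists>B. finite_dimensional_vector_space scale B"
    and "lie_algebra.solvable scale bracket"
    and "CHAR('a) = p"
    and "\<exists>d. lie_algebra.nonsingular_derivation scale bracket d \<and> finite_order d"
    and "p = 0 \<or>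
      (\<forall>i. vector_space_quotient.quot_dim scale (lie_algebra.derived_series scale bracket i)
             (lie_algebra.derived_series scale bracket (Suc i)) < p)"
  shows "lie_algebra.nilpotent scale bracket"
proof -
  interpret L: lie_algebra scale bracket by fact
  obtain B where B: "finite_dimensional_vector_space scale B" using assms(2) by blast
  obtain d where d: "L.nonsingular_derivation d" "finite_order d" using assms(5) by blast
  interpret F: finite_dimensional_vector_space scale B by (rule B)
  interpret Q: vector_space_quotient scale ..
  interpret D: lie_algebra_derivation scale bracket B d
    by unfold_locales (use d in \<open>simp_all add: L.nonsingular_derivation_def\<close>)
  \<comment> \<open>If \<open>p > 0\<close>, a positive \<open>k\<close> up to the dimension of a
    derived factor is below \<open>p\<close>, hence not divisible by \<open>p\<close>; for
    \<open>p = 0\<close>, only \<open>0\<close> is divisible by \<open>p\<close>.\<close>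
  have "(of_nat k :: 'a) \<noteq> 0"
    if "0 < k" "k \<le> L.dim (L.derived_series i) - L.dim (L.derived_series (Suc i))" for i k
  proof (cases "p = 0")
    case True
    then show ?thesis using assms(4) that by (simp add: of_nat_eq_0_iff_char_dvd)
  next
    case False
    have "L.dim (L.derived_series i) - L.dim (L.derived_series (Suc i)) =
      Q.quot_dim (L.derived_series i) (L.derived_series (Suc i))"
      using D.d_ideal_derived_series D.derived_series_Suc_subset
      by (intro Q.quot_dim_eq[OF B, symmetric]) (auto simp only: D.d_ideal_def)
    then have "k < p" using that assms(6) False by (metis le_less_trans)
    then show ?thesis using assms(4) that by (auto simp: of_nat_eq_0_iff_char_dvd dest: dvd_imp_le)
  qed
  then have sub: "\<exists>c. L.lower_central_series c \<subseteq> L.derived_series i" for i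
    by (rule D.lower_central_series_subset_derived)
  obtain n where "L.derived_series n = {0}" using assms(3) by (auto simp: L.solvable_def)
  then obtain c where "L.lower_central_series c \<subseteq> {0}" using sub[of n] by auto
  moreover have "0 \<in> L.lower_central_series c"
    using D.d_ideal_lower_central_series L.subspace_0 by (auto simp: D.d_ideal_def)
  ultimately show ?thesis unfolding L.nilpotent_def by blast
qed

end
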